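(* Let $d\ge1$, let $\Omega=\mathbb{R}^d$ and let $\mathbf z$ have the multivariate standard normal probability distribution $\mathbf F$ on $\mathbb{R}^d$ (with standard normal marginals $F_1,\ldots,F_d$). Let $f(\mathbf z)=\frac12\mathbf z^T\mathbf A\mathbf z+\mathbf b^T\mathbf z$, where $\mathbf A$ is a symmetric real $d\times d$ matrix and $\mathbf b\in\mathbb{R}^d$, and assume $\sigma^2=\mathrm{Var}(f(\mathbf z))>0$. Then for every $i=1,\ldots,d$, $$\bar S_i=\frac{\gamma_i(d)}{\sigma^2},$$ where $\bar S_i$ is the (generalized) upper Sobol' index of the $i$th input and $\gamma_i(d)$ is the global activity score of the $i$th parameter with $m=d$.
   Context: Notation: for $\mathbf v,\mathbf z\in\mathbb{R}^d$, $(\mathbf v_{\{i\}}{:}\mathbf z_{-\{i\}})$ is the vector whose $i$th component is $v_i$ and whose $j$th component is $z_j$ for $j\ne i$. Generalized upper Sobol' index: $$\bar S_i=\frac{1}{2\sigma^2}\int \big(f(\mathbf z)-f(\mathbf v_{\{i\}}{:}\mathbf z_{-\{i\}})\big)^2\,d\mathbf F(\mathbf z)\,dF_i(v_i),$$ where $\sigma^2$ is the variance of $f(\mathbf z)$ for $\mathbf z\sim\mathbf F$. Global activity scores: let $\mathbf v,\mathbf z$ be independent random vectors, both with distribution $\mathbf F$. Define $$D_{\mathbf z,i}f(v_i,\mathbf z)=\frac{f(\mathbf v_{\{i\}}{:}\mathbf z_{-\{i\}})-f(\mathbf z)}{v_i-z_i},\qquad D_{\mathbf z}f(\mathbf v,\mathbf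 z)=[D_{\mathbf z,1}f(v_1,\mathbf z),\ldots,D_{\mathbf z,d}f(v_d,\mathbf z)]^T,$$ (defined almost surely), and the $d\times d$ symmetric positive semidefinite matrix $$\mathbf C_{\rm gas}=\mathbb{E}\big[\mathbb{E}[(D_{\mathbf z}f)(D_{\mathbf z}f)^T\mid \mathbf z]\big].$$ Let $\mathbf C_{\rm gas}=\mathbf U\Lambda\mathbf U^T$ be an eigenvalue decomposition, with $\mathbf U=[\mathbf u_1,\ldots,\mathbf u_d]$ orthogonal, $\mathbf u_j=[u_{1j},\ldots,u_{dj}]^T$, and $\Lambda=\mathrm{diag}(\lambda_1,\ldots,\lambda_d)$, $\lambda_1\ge\cdots\ge\lambda_d\ge0$. For $m\le d$ the global activity score of the $i$th parameter is $\gamma_i(m)=\sum_{j=1}^m\lambda_j u_{ij}^2$. *)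

theory Defs
  imports "HOL-Probability.Probability" "Jordan_Normal_Form.Matrix"
begin

text \<open>
  Components are numbered from 0, so the index set 1..d becomes \<open>{..<d}\<close>. Points of the
  d-dimensional sample space are elements of \<open>\<Pi>\<^sub>M k\<in>{..<d}. G k\<close>, that is, functions on the
  index set (with the fixed value \<open>undefined\<close> outside it), where \<open>G k\<close> is the distribution of the
  k-th component. The vector with i-th component \<open>v i\<close> and all other components
  those of \<open>z\<close> is therefore the function update \<open>z(i := v i)\<close>.
\<close>

definition std_normal_measure :: "nat \<Rightarrow> (nat \<Rightarrow> real) measure" where
  "std_normal_measure d = (\<Pi>\<^sub>M k\<in>{..<d}. std_normal_distribution)"

definition quadratic_fun :: "nat \<Rightarrow> real mat \<Rightarrow> real vec \<Rightarrow> (nat \<Rightarrow> real) \<Rightarrow> real" where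
  "quadratic_fun d A b z =
     1/2 * scalar_prod (Matrix.vec d z) (A *\<^sub>v Matrix.vec d z) + scalar_prod b (Matrix.vec d z)"

definition upper_sobol ::
  "nat \<Rightarrow> (nat \<Rightarrow> real measure) \<Rightarrow> ((nat \<Rightarrow> real) \<Rightarrow> real) \<Rightarrow> nat \<Rightarrow> real" where
  "upper_sobol d G f i =
     (let F = (\<Pi>\<^sub>M k\<in>{..<d}. G k)
      in 1 / (2 * prob_space.variance F f) *
         (\<integral>(z, x). (f z - f (z(i := x)))\<^sup>2 \<partial>(F \<Otimes>\<^sub>M G i)))"

text \<open>
  The difference quotient is undefined where \<open>x = z i\<close>; division by zero makes it 0 there.
  For distributions without atoms this is a null set.
\<close>

definition diff_quot ::
  "((nat \<Rightarrow> real) \<Rightarrow> real) \<Rightarrow> nat \<Rightarrow> real \<Rightarrow> (nat \<Rightarrow> real) \<Rightarrow> real" where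
  "diff_quot f i x z = (f (z(i := x)) - f z) / (x - z i)"

definition diff_quot_vec ::
  "nat \<Rightarrow> ((nat \<Rightarrow> real) \<Rightarrow> real) \<Rightarrow> (nat \<Rightarrow> real) \<Rightarrow> (nat \<Rightarrow> real) \<Rightarrow> real vec" where
  "diff_quot_vec d f v z = Matrix.vec d (\<lambda>i. diff_quot f i (v i) z)"

text \<open>
  \<open>M\<close> is the underlying probability space and \<open>v\<close>, \<open>z\<close> are random vectors on it with values
  in \<open>F\<close>. The expectation of a random matrix is taken entrywise; conditioning on \<open>z\<close> is
  conditioning on the sigma-algebra generated by \<open>z\<close>.
\<close>

definition C_gas ::
  "nat \<Rightarrow> (nat \<Rightarrow> real) measure \<Rightarrow> 'a measure \<Rightarrow> ('a \<Rightarrow> nat \<Rightarrow> real) \<Rightarrow> ('a \<Rightarrow> nat \<Rightarrow> real) \<Rightarrow>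
   ((nat \<Rightarrow> real) \<Rightarrow> real) \<Rightarrow> real mat" where
  "C_gas d F M v z f = Matrix.mat d d (\<lambda>(i, j).
     prob_space.expectation M
       (real_cond_exp M (vimage_algebra (space M) z F)
         (\<lambda>\<omega>. vec_index (diff_quot_vec d f (v \<omega>) (z \<omega>)) i *
               vec_index (diff_quot_vec d f (v \<omega>) (z \<omega>)) j)))"

text \<open>
  The orthogonality condition is spelled out because \<open>orthogonal_mat\<close> only asks for pairwise
  orthogonal nonzero columns, not for unit ones.
\<close>

definition eigen_decomposition :: "nat \<Rightarrow> real mat \<Rightarrow> real mat \<Rightarrow> (nat \<Rightarrow> real) \<Rightarrow> bool" where
  "eigen_decomposition d C U lam \<longleftrightarrow>
     U \<in> carrier_mat d d \<and>
     transpose_mat U * U = 1\<^sub>m d \<and> U * transpose_mat U = 1\<^sub>m d \<and>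
     C = U * mat_diag d lam * transpose_mat U \<and>
     (\<forall>j k. j \<le> k \<and> k < d \<longrightarrow> lam k \<le> lam j) \<and>
     (\<forall>j<d. 0 \<le> lam j)"

definition activity_score :: "real mat \<Rightarrow> (nat \<Rightarrow> real) \<Rightarrow> nat \<Rightarrow> nat \<Rightarrow> real" where
  "activity_score U lam m i = (\<Sum>j<m. lam j * (U $$ (i, j))\<^sup>2)"

end

theory Submission
  imports Defs
begin

text \<open>
  Fix all coordinates but the \<open>i\<close>-th. In that coordinate \<open>f\<close> is a quadratic polynomial
  \<open>p + r x + a x\<^sup>2 / 2\<close> with \<open>a = A\<^sub>i\<^sub>i\<close> and a coefficient \<open>r\<close> that depends on the other coordinates.
  So for independent standard normal \<open>x\<close> and \<open>s\<close> the increment factors as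
  \<open>f(x) - f(s) = (x - s) (r + a (x + s) / 2)\<close>. The two factors are independent, because
  \<open>x - s\<close> and \<open>x + s\<close> are independent for Gaussian variables, and the first has second moment 2.
  Hence the mean square of the increment is exactly twice the mean square of the difference
  quotient, for every value of the other coordinates and, by Fubini, after averaging over them.
  The mean square of the increment is \<open>2 \<sigma>\<^sup>2\<close> times the upper Sobol' index, and the mean square of
  the difference quotient is the \<open>i\<close>-th diagonal entry of the matrix of the global activity scores.
  That entry, read off from the eigenvalue decomposition, is the score with all eigenvectors.

  The formal proof computes both mean squares from the first four moments of the normal distribution
  instead of using the independence of \<open>x - s\<close> and \<open>x + s\<close>: given \<open>r\<close>, they are \<open>2 r\<^sup>2 + a\<^sup>2\<close> and
  \<open>r\<^sup>2 + a\<^sup>2 / 2\<close> (\<open>nn_integral_increment_sq\<close> and \<open>nn_integral_quotient_sq\<close>). The lemma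
  \<open>has_bochner_integral_PiM_resample\<close> is the Fubini step. The finite second moment of \<open>r\<close> makes the
  squared quotient integrable, which is what allows the conditional expectation given \<open>z\<close>
  to be averaged out.
\<close>

section \<open>Gaussian mean squares of a quadratic polynomial in one variable\<close>

lemma prob_space_std_normal: "prob_space std_normal_distribution"
  by (rule prob_space_normal_density) simp

lemma nn_integral_std_normal_quartic:
  fixes c0 c1 c2 c3 c4 :: real
  assumes nonneg: "\<And>x. 0 \<le> c0 + c1 * x + c2 * x^2 + c3 * x^3 + c4 * x^4"
  shows "(\<integral>\<^sup>+x. ennreal (c0 + c1 * x + c2 * x^2 + c3 * x^3 + c4 * x^4) \<partial>std_normal_distribution)
       = ennreal (c0 + c2 + 3 * c4)"
proof -
  interpret N: prob_space std_normal_distribution by (rule prob_space_std_normal)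
  note int = integrable_std_normal_distribution_moment
  have m1: "integrable std_normal_distribution (\<lambda>x. x)"
    using int[of 1] by simp
  have "(LINT x|std_normal_distribution. x) = 0"
       "(LINT x|std_normal_distribution. x^2) = 1"
       "(LINT x|std_normal_distribution. x^3) = 0"
       "(LINT x|std_normal_distribution. x^4) = 3"
    using integral_std_normal_distribution_moment_odd[of 1]
      integral_std_normal_distribution_moment_odd[of 3]
      std_normal_distribution_even_moments(1)[of 1] std_normal_distribution_even_moments(1)[of 2]
    by (simp_all add: fact_numeral)
  then have "(LINT x|std_normal_distribution. c0 + c1 * x + c2 * x^2 + c3 * x^3 + c4 * x^4)
      = c0 + c2 + 3 * c4"
    using m1 int[of 2] int[of 3] int[of 4] N.prob_space by simp
  moreover have "integrable std_normal_distribution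
      (\<lambda>x. c0 + c1 * x + c2 * x^2 + c3 * x^3 + c4 * x^4)"
    using m1 int[of 2] int[of 3] int[of 4] by simp
  ultimately show ?thesis
    using nonneg by (simp add: nn_integral_eq_integral)
qed

text \<open>
  Expanding the square gives a quartic in \<open>x\<close> and, after integrating over \<open>x\<close>, again a quartic
  in \<open>s\<close>.
\<close>

lemma nn_integral_increment_sq:
  fixes r a :: real
  shows "(\<integral>\<^sup>+s. \<integral>\<^sup>+x. ennreal (((r * x + a/2 * x^2) - (r * s + a/2 * s^2))^2)
            \<partial>std_normal_distribution \<partial>std_normal_distribution) = ennreal (2 * r^2 + a^2)"
proof -
  have inner: "(\<integral>\<^sup>+x. ennreal (((r * x + a/2 * x^2) - q)^2) \<partial>std_normal_distribution)
      = ennreal (q^2 + r^2 - a * q + 3/4 * a^2)" for q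
  proof -
    have poly: "((r * x + a/2 * x^2) - q)^2
        = q^2 + (-2 * q * r) * x + (r^2 - a * q) * x^2 + (a * r) * x^3 + (a^2/4) * x^4" for x
      by (simp add: power2_eq_square power3_eq_cube power4_eq_xxxx field_simps)
    have "(\<integral>\<^sup>+x. ennreal (((r * x + a/2 * x^2) - q)^2) \<partial>std_normal_distribution)
        = ennreal (q^2 + (r^2 - a * q) + 3 * (a^2/4))"
      unfolding poly by (rule nn_integral_std_normal_quartic) (simp only: zero_le_power2 flip: poly)
    then show ?thesis by (simp add: algebra_simps)
  qed
  have nonneg: "0 \<le> q^2 + r^2 - a * q + 3/4 * a^2" for q
  proof -
    have "q^2 + r^2 - a * q + 3/4 * a^2 = (q - a/2)^2 + r^2 + a^2/2"
      by (simp add: power2_eq_square field_simps)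
    also have "\<dots> \<ge> 0" by simp
    finally show ?thesis .
  qed
  have poly: "(r * s + a/2 * s^2)^2 + r^2 - a * (r * s + a/2 * s^2) + 3/4 * a^2
      = (r^2 + 3/4 * a^2) + (- a * r) * s + (r^2 - a^2/2) * s^2 + (a * r) * s^3 + (a^2/4) * s^4" for s
    by (simp add: power2_eq_square power3_eq_cube power4_eq_xxxx field_simps)
  have "(\<integral>\<^sup>+s. ennreal ((r * s + a/2 * s^2)^2 + r^2 - a * (r * s + a/2 * s^2) + 3/4 * a^2)
            \<partial>std_normal_distribution) = ennreal ((r^2 + 3/4 * a^2) + (r^2 - a^2/2) + 3 * (a^2/4))"
    unfolding poly by (rule nn_integral_std_normal_quartic) (simp only: nonneg flip: poly)
  then show ?thesis
    unfolding inner by (simp add: algebra_simps)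
qed

text \<open>
  Off the diagonal \<open>x = s\<close>, which is a null set, the quotient is the affine function
  \<open>r + a (x + s) / 2\<close>.
\<close>

lemma nn_integral_quotient_sq:
  fixes r a :: real
  shows "(\<integral>\<^sup>+s. \<integral>\<^sup>+x. ennreal ((((r * x + a/2 * x^2) - (r * s + a/2 * s^2)) / (x - s))^2)
            \<partial>std_normal_distribution \<partial>std_normal_distribution) = ennreal (r^2 + a^2/2)"
proof -
  have inner: "(\<integral>\<^sup>+x. ennreal ((((r * x + a/2 * x^2) - (r * s + a/2 * s^2)) / (x - s))^2)
          \<partial>std_normal_distribution)
      = ennreal ((r + a/2 * s)^2 + a^2/4)" for s
  proof -
    let ?k = "r + a/2 * s"
    have poly: "(?k + a/2 * x)^2
        = ?k^2 + (a * ?k) * x + (a^2/4) * x^2 + 0 * x^3 + 0 * x^4" for x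
      by (simp add: power2_eq_square field_simps)
    have "AE x in std_normal_distribution. x \<noteq> s"
      by (subst AE_density) (use AE_lborel_singleton[of s] in auto)
    then have "(\<integral>\<^sup>+x. ennreal ((((r * x + a/2 * x^2) - (r * s + a/2 * s^2)) / (x - s))^2)
          \<partial>std_normal_distribution)
        = (\<integral>\<^sup>+x. ennreal ((?k + a/2 * x)^2) \<partial>std_normal_distribution)"
    proof (intro nn_integral_cong_AE, eventually_elim)
      case (elim x)
      have "(r * x + a/2 * x^2) - (r * s + a/2 * s^2) = (?k + a/2 * x) * (x - s)"
        by (simp add: power2_eq_square field_simps)
      then show ?case
        using elim by simp
    qed
    also have "\<dots> = ennreal (?k^2 + a^2/4 + 3 * 0)"
      unfolding poly by (rule nn_integral_std_normal_quartic) (simp only: zero_le_power2 flip: poly)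
    finally show ?thesis by simp
  qed
  have poly: "(r + a/2 * s)^2 + a^2/4
      = (r^2 + a^2/4) + (a * r) * s + (a^2/4) * s^2 + 0 * s^3 + 0 * s^4" for s
    by (simp add: power2_eq_square field_simps)
  have "(\<integral>\<^sup>+s. ennreal ((r + a/2 * s)^2 + a^2/4) \<partial>std_normal_distribution)
      = ennreal ((r^2 + a^2/4) + a^2/4 + 3 * 0)"
    unfolding poly
    by (rule nn_integral_std_normal_quartic) (simp only: zero_le_power2 add_nonneg_nonneg
        divide_nonneg_pos zero_less_numeral flip: poly)
  then show ?thesis
    unfolding inner by simp
qed

section \<open>Integration over a product space with one resampled coordinate\<close>

text \<open>
  The expectation of \<open>h\<close> is the average over the other coordinates of the partial expectation in
  the coordinate \<open>i\<close> and its independent copy. Nonnegativity makes Fubini unconditional, so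
  integrability of \<open>h\<close> follows from that of the partial expectations \<open>g\<close>.
\<close>

lemma has_bochner_integral_PiM_resample:
  fixes h :: "('i \<Rightarrow> 'b) \<Rightarrow> 'b \<Rightarrow> real" and g :: "('i \<Rightarrow> 'b) \<Rightarrow> real"
  assumes N: "prob_space N" and I: "finite I" "i \<notin> I"
    and h: "(\<lambda>(z, x). h z x) \<in> borel_measurable ((\<Pi>\<^sub>M k\<in>insert i I. N) \<Otimes>\<^sub>M N)"
    and nonneg: "\<And>z x. 0 \<le> h z x"
    and g: "integrable (\<Pi>\<^sub>M k\<in>I. N) g" "\<And>X. 0 \<le> g X"
    and partial: "\<And>X. (\<integral>\<^sup>+s. \<integral>\<^sup>+x. ennreal (h (X(i := s)) x) \<partial>N \<partial>N) = ennreal (g X)"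
  shows "has_bochner_integral ((\<Pi>\<^sub>M k\<in>insert i I. N) \<Otimes>\<^sub>M N) (\<lambda>(z, x). h z x)
           (\<integral>X. g X \<partial>(\<Pi>\<^sub>M k\<in>I. N))"
proof -
  interpret N: prob_space N by fact
  interpret P: product_sigma_finite "\<lambda>_. N" by standard
  note [measurable] = h
  have "(\<integral>\<^sup>+p. ennreal (case p of (z, x) \<Rightarrow> h z x) \<partial>((\<Pi>\<^sub>M k\<in>insert i I. N) \<Otimes>\<^sub>M N))
      = (\<integral>\<^sup>+z. \<integral>\<^sup>+x. ennreal (h z x) \<partial>N \<partial>(\<Pi>\<^sub>M k\<in>insert i I. N))"
    by (subst N.nn_integral_fst[symmetric]) simp_all
  also have "\<dots> = (\<integral>\<^sup>+X. \<integral>\<^sup>+s. \<integral>\<^sup>+x. ennreal (h (X(i := s)) x) \<partial>N \<partial>N \<partial>(\<Pi>\<^sub>M k\<in>I. N))"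
    by (rule P.product_nn_integral_insert) (use I in \<open>simp_all\<close>)
  also have "\<dots> = ennreal (\<integral>X. g X \<partial>(\<Pi>\<^sub>M k\<in>I. N))"
    unfolding partial using g by (intro nn_integral_eq_integral) simp_all
  finally show ?thesis
    using nonneg g by (intro has_bochner_integral_nn_integral) (auto intro!: integral_nonneg)
qed

lemma integrable_add_sq:
  fixes f g :: "'a \<Rightarrow> real"
  assumes [measurable]: "f \<in> borel_measurable M" "g \<in> borel_measurable M"
    and "integrable M (\<lambda>x. (f x)^2)" "integrable M (\<lambda>x. (g x)^2)"
  shows "integrable M (\<lambda>x. (f x + g x)^2)"
proof (rule Bochner_Integration.integrable_bound)
  show "integrable M (\<lambda>x. 2 * (f x)^2 + 2 * (g x)^2)"
    using assms by simp
  have "(p + q)^2 \<le> 2 * p^2 + 2 * q^2" for p q :: real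
    using zero_le_power2[of "p - q"] unfolding power2_sum power2_diff by linarith
  then show "AE x in M. norm ((f x + g x)^2) \<le> norm (2 * (f x)^2 + 2 * (g x)^2)"
    by simp
qed simp

lemma integrable_affine_sq_PiM_std_normal:
  fixes c :: real and w :: "'i \<Rightarrow> real"
  assumes "finite I"
  shows "integrable (\<Pi>\<^sub>M k\<in>I. std_normal_distribution) (\<lambda>X. ((\<Sum>k\<in>I. w k * X k) + c)^2)"
proof -
  interpret P: product_prob_space "\<lambda>_. std_normal_distribution" I
    by (simp add: product_prob_spaceI prob_space_std_normal)
  let ?F = "\<Pi>\<^sub>M k\<in>I. std_normal_distribution"
  have coord [measurable]: "(\<lambda>X. X k) \<in> measurable ?F std_normal_distribution" if "k \<in> I" for k
    using that by (rule measurable_component_singleton)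
  then have [measurable]: "(\<lambda>X. X k) \<in> borel_measurable ?F" if "k \<in> I" for k
    using that by (simp cong: measurable_cong_sets)
  have sq: "integrable ?F (\<lambda>X. (X k)^2)" if k: "k \<in> I" for k
  proof (rule integrable_distr[OF coord[OF k]])
    show "integrable (distr ?F std_normal_distribution (\<lambda>X. X k)) (\<lambda>x. x^2)"
      using integrable_std_normal_distribution_moment[of 2] P.PiM_component[OF k] by simp
  qed
  have "integrable ?F (\<lambda>X. (\<Sum>k\<in>J. w k * X k)^2)" if "J \<subseteq> I" for J
    using finite_subset[OF that \<open>finite I\<close>] that
  proof (induction J rule: finite_induct)
    case (insert k J)
    then have "integrable ?F (\<lambda>X. (w k * X k + (\<Sum>j\<in>J. w j * X j))^2)"
      by (intro integrable_add_sq borel_measurable_sum) (auto simp: power_mult_distrib sq)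
    then show ?case
      using insert.hyps by simp
  qed simp
  then show ?thesis
    by (intro integrable_add_sq borel_measurable_sum) simp_all
qed

section \<open>Quadratic functions along one coordinate\<close>

definition cross_coeff :: "nat \<Rightarrow> real mat \<Rightarrow> real vec \<Rightarrow> nat \<Rightarrow> (nat \<Rightarrow> real) \<Rightarrow> real" where
  "cross_coeff d A b i z = (\<Sum>k\<in>{..<d} - {i}. A $$ (i, k) * z k) + b $ i"

lemma cross_coeff_upd [simp]: "cross_coeff d A b i (z(i := x)) = cross_coeff d A b i z"
  by (simp add: cross_coeff_def)

lemma quadratic_fun_eq_sum:
  assumes "A \<in> carrier_mat d d" "b \<in> carrier_vec d"
  shows "quadratic_fun d A b z
    = 1/2 * (\<Sum>k<d. \<Sum>l<d. A $$ (k, l) * z k * z l) + (\<Sum>k<d. b $ k * z k)"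
  using assms
  by (auto simp: quadratic_fun_def scalar_prod_def atLeast0LessThan sum_distrib_left mult.assoc
      mult.left_commute intro!: sum.cong)

lemma quadratic_fun_upd:
  assumes A: "A \<in> carrier_mat d d" "transpose_mat A = A" and b: "b \<in> carrier_vec d"
    and i: "i < d"
  shows "quadratic_fun d A b (z(i := x))
    = quadratic_fun d A b (z(i := 0)) + (cross_coeff d A b i z * x + A $$ (i, i) / 2 * x^2)"
proof -
  let ?S = "{..<d} - {i}"
  have sym: "A $$ (k, i) = A $$ (i, k)" if "k < d" for k
    using A i that by (metis carrier_matD index_transpose_mat(1))
  \<comment> \<open>The double sum splits according to which of its two indices equal \<open>i\<close>; the two mixed
    parts agree by symmetry, which is where the factor 2 comes from.\<close>
  have expand: "quadratic_fun d A b (z(i := y))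
      = 1/2 * (A $$ (i, i) * y^2 + 2 * (y * (\<Sum>k\<in>?S. A $$ (i, k) * z k))
               + (\<Sum>k\<in>?S. \<Sum>l\<in>?S. A $$ (k, l) * z k * z l))
        + (b $ i * y + (\<Sum>k\<in>?S. b $ k * z k))" for y
  proof -
    have split: "(\<Sum>k<d. g k) = g i + (\<Sum>k\<in>?S. g k)" for g :: "nat \<Rightarrow> real"
      using i by (intro sum.remove) auto
    have "(\<Sum>k<d. \<Sum>l<d. A $$ (k, l) * (z(i := y)) k * (z(i := y)) l)
        = A $$ (i, i) * y * y + (\<Sum>l\<in>?S. A $$ (i, l) * y * z l)
          + (\<Sum>k\<in>?S. A $$ (k, i) * z k * y + (\<Sum>l\<in>?S. A $$ (k, l) * z k * z l))"
      unfolding split by (auto intro!: arg_cong2[where f = "(+)"] sum.cong)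
    also have "(\<Sum>k\<in>?S. A $$ (k, i) * z k * y + (\<Sum>l\<in>?S. A $$ (k, l) * z k * z l))
        = (\<Sum>k\<in>?S. A $$ (i, k) * y * z k) + (\<Sum>k\<in>?S. \<Sum>l\<in>?S. A $$ (k, l) * z k * z l)"
      unfolding sum.distrib by (auto intro!: sum.cong simp: sym)
    also have "(\<Sum>k\<in>?S. A $$ (i, k) * y * z k) = y * (\<Sum>k\<in>?S. A $$ (i, k) * z k)"
      by (simp add: sum_distrib_left mult_ac)
    finally have quad: "(\<Sum>k<d. \<Sum>l<d. A $$ (k, l) * (z(i := y)) k * (z(i := y)) l)
        = A $$ (i, i) * y^2 + 2 * (y * (\<Sum>k\<in>?S. A $$ (i, k) * z k))
          + (\<Sum>k\<in>?S. \<Sum>l\<in>?S. A $$ (k, l) * z k * z l)"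
      by (simp add: power2_eq_square)
    have lin: "(\<Sum>k<d. b $ k * (z(i := y)) k) = b $ i * y + (\<Sum>k\<in>?S. b $ k * z k)"
      unfolding split by (auto intro!: sum.cong)
    show ?thesis
      unfolding quadratic_fun_eq_sum[OF A(1) b] quad lin ..
  qed
  show ?thesis
    unfolding expand cross_coeff_def by (simp add: algebra_simps)
qed

lemma borel_measurable_quadratic_fun:
  assumes "A \<in> carrier_mat d d" "b \<in> carrier_vec d"
  shows "quadratic_fun d A b \<in> borel_measurable (std_normal_measure d)"
proof -
  have [measurable]: "(\<lambda>z. z k) \<in> borel_measurable (std_normal_measure d)" if "k < d" for k
    using measurable_component_singleton[of k "{..<d}" "\<lambda>_. std_normal_distribution"] that
    unfolding std_normal_measure_def by (simp cong: measurable_cong_sets)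
  show ?thesis
    unfolding quadratic_fun_eq_sum[OF assms, abs_def] by (simp add: borel_measurable_sum)
qed

section \<open>The upper Sobol' integral and the diagonal of the activity score matrix\<close>

text \<open>
  Both mean squares are averages over the coordinates other than \<open>i\<close>, and there the integrand
  \<open>2 r\<^sup>2 + a\<^sup>2\<close> of the first is twice the integrand \<open>r\<^sup>2 + a\<^sup>2 / 2\<close> of the second.
\<close>

lemma quadratic_mean_squares:
  fixes A :: "real mat" and b :: "real vec" and d i :: nat
  assumes A: "A \<in> carrier_mat d d" "transpose_mat A = A" and b: "b \<in> carrier_vec d"
    and i: "i < d"
  defines "f \<equiv> quadratic_fun d A b"
    and "K \<equiv> std_normal_measure d \<Otimes>\<^sub>M std_normal_distribution"
  shows "integrable K (\<lambda>(z, x). (diff_quot f i x z)^2)"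
    and "(\<integral>(z, x). (f z - f (z(i := x)))^2 \<partial>K) = 2 * (\<integral>(z, x). (diff_quot f i x z)^2 \<partial>K)"
proof -
  let ?S = "{..<d} - {i}"
  let ?a = "A $$ (i, i)"
  let ?r = "cross_coeff d A b i"
  let ?F' = "\<Pi>\<^sub>M k\<in>?S. std_normal_distribution"
  have ins: "insert i ?S = {..<d}" using i by auto
  have K: "K = (\<Pi>\<^sub>M k\<in>insert i ?S. std_normal_distribution) \<Otimes>\<^sub>M std_normal_distribution"
    unfolding K_def std_normal_measure_def ins ..
  interpret F': prob_space ?F'
    by (intro prob_space_PiM prob_space_std_normal)
  have r2: "integrable ?F' (\<lambda>X. (?r X)^2)"
    unfolding cross_coeff_def by (rule integrable_affine_sq_PiM_std_normal) simp
  have upd: "(\<lambda>(z, x). z(i := x)) \<in> measurable K (std_normal_measure d)"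
    unfolding K_def std_normal_measure_def case_prod_beta
    by (rule measurable_fun_upd[where J = "{..<d}"]) (use i in auto)
  note fm = borel_measurable_quadratic_fun[OF A(1) b, folded f_def]
  have [measurable]: "(\<lambda>p. f ((fst p)(i := snd p))) \<in> borel_measurable K"
    using measurable_compose[OF upd fm] by (simp add: case_prod_beta)
  have [measurable]: "(\<lambda>p. f (fst p)) \<in> borel_measurable K"
    using fm unfolding K_def by simp
  have [measurable]: "(\<lambda>p. snd p) \<in> borel_measurable K"
    unfolding K_def by (simp cong: measurable_cong_sets add: measurable_snd'')
  have [measurable]: "(\<lambda>p. fst p i) \<in> borel_measurable K"
  proof -
    have "(\<lambda>z. z i) \<in> measurable (std_normal_measure d) std_normal_distribution"
      unfolding std_normal_measure_def using i by simp
    then show ?thesis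
      unfolding K_def by (auto cong: measurable_cong_sets intro: measurable_compose[OF measurable_fst])
  qed
  have along: "f (X(i := x)) = f (X(i := 0)) + (?r X * x + ?a/2 * x^2)" for X x
    unfolding f_def by (rule quadratic_fun_upd[OF A b i])
  have increment: "has_bochner_integral K (\<lambda>(z, x). (f z - f (z(i := x)))^2)
      (\<integral>X. 2 * (?r X)^2 + ?a^2 \<partial>?F')"
    unfolding K
  proof (rule has_bochner_integral_PiM_resample[OF prob_space_std_normal])
    show "(\<lambda>(z, x). (f z - f (z(i := x)))^2) \<in> borel_measurable
        ((\<Pi>\<^sub>M k\<in>insert i ?S. std_normal_distribution) \<Otimes>\<^sub>M std_normal_distribution)"
      unfolding K[symmetric] case_prod_beta by measurable
    fix X
    have "(f (X(i := s)) - f (X(i := s, i := x)))^2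
        = ((?r X * x + ?a/2 * x^2) - (?r X * s + ?a/2 * s^2))^2" for s x
      unfolding fun_upd_upd along[of X s] along[of X x] by (simp add: power2_commute)
    then show "(\<integral>\<^sup>+s. \<integral>\<^sup>+x. ennreal ((f (X(i := s)) - f (X(i := s, i := x)))^2)
        \<partial>std_normal_distribution \<partial>std_normal_distribution) = ennreal (2 * (?r X)^2 + ?a^2)"
      by (simp only: nn_integral_increment_sq)
  qed (use r2 in auto)
  have quotient: "has_bochner_integral K (\<lambda>(z, x). (diff_quot f i x z)^2)
      (\<integral>X. (?r X)^2 + ?a^2/2 \<partial>?F')"
    unfolding K
  proof (rule has_bochner_integral_PiM_resample[OF prob_space_std_normal])
    show "(\<lambda>(z, x). (diff_quot f i x z)^2) \<in> borel_measurable
        ((\<Pi>\<^sub>M k\<in>insert i ?S. std_normal_distribution) \<Otimes>\<^sub>M std_normal_distribution)"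
      unfolding K[symmetric] case_prod_beta diff_quot_def by measurable
    fix X
    have "diff_quot f i x (X(i := s))
        = ((?r X * x + ?a/2 * x^2) - (?r X * s + ?a/2 * s^2)) / (x - s)" for s x
      unfolding diff_quot_def fun_upd_upd along[of X s] along[of X x] by simp
    then show "(\<integral>\<^sup>+s. \<integral>\<^sup>+x. ennreal ((diff_quot f i x (X(i := s)))^2)
        \<partial>std_normal_distribution \<partial>std_normal_distribution) = ennreal ((?r X)^2 + ?a^2/2)"
      by (simp only: nn_integral_quotient_sq)
  qed (use r2 in auto)
  show "integrable K (\<lambda>(z, x). (diff_quot f i x z)^2)"
    using quotient by (rule integrable.intros)
  have "(\<integral>X. 2 * (?r X)^2 + ?a^2 \<partial>?F') = 2 * (\<integral>X. (?r X)^2 + ?a^2/2 \<partial>?F')"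
    using r2 F'.prob_space by simp
  then show "(\<integral>(z, x). (f z - f (z(i := x)))^2 \<partial>K) = 2 * (\<integral>(z, x). (diff_quot f i x z)^2 \<partial>K)"
    using increment quotient by (simp add: has_bochner_integral_integral_eq)
qed

text \<open>
  Averaging a conditional expectation gives the unconditional one, and the diagonal entry uses
  from \<open>v\<close> only its \<open>i\<close>-th component, a standard normal variable independent of \<open>z\<close>.
\<close>

lemma C_gas_diagonal:
  fixes f :: "(nat \<Rightarrow> real) \<Rightarrow> real"
  assumes M: "prob_space M"
    and indep: "prob_space.indep_var M (std_normal_measure d) v (std_normal_measure d) z"
    and v: "distr M (std_normal_measure d) v = std_normal_measure d"
    and z: "distr M (std_normal_measure d) z = std_normal_measure d"
    and i: "i < d"
    and int: "integrable (std_normal_measure d \<Otimes>\<^sub>M std_normal_distribution)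
                (\<lambda>(z, x). (diff_quot f i x z)^2)"
  shows "C_gas d (std_normal_measure d) M v z f $$ (i, i)
    = (\<integral>(z, x). (diff_quot f i x z)^2 \<partial>(std_normal_measure d \<Otimes>\<^sub>M std_normal_distribution))"
proof -
  let ?F = "std_normal_measure d"
  let ?N = std_normal_distribution
  interpret M: prob_space M by fact
  have rv: "v \<in> measurable M ?F" "z \<in> measurable M ?F"
    using M.indep_var_rv1[OF indep] M.indep_var_rv2[OF indep] by auto
  interpret S: finite_measure_subalgebra M "vimage_algebra (space M) z ?F"
  proof
    show "subalgebra M (vimage_algebra (space M) z ?F)"
      using rv(2) by (auto simp: subalgebra_def measurable_def sets_vimage_algebra2)
  qed
  have coord: "(\<lambda>X. X i) \<in> measurable ?F ?N"
    unfolding std_normal_measure_def using i by (intro measurable_component_singleton) simp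
  have vi_rv: "(\<lambda>\<omega>. v \<omega> i) \<in> measurable M ?N"
    using measurable_compose[OF rv(1) coord] .
  interpret F: prob_space ?F
    unfolding std_normal_measure_def by (intro prob_space_PiM prob_space_std_normal)
  interpret N: prob_space ?N by (rule prob_space_std_normal)
  interpret FF: pair_sigma_finite ?F ?F ..
  \<comment> \<open>The joint law of \<open>(z, v i)\<close> is the image of the product law of \<open>(v, z)\<close> under a swap and
    a projection. It is computed with image measures, since \<open>indep_var\<close> relates only
    variables with values in the same type.\<close>
  let ?swap = "\<lambda>(X, Y). (Y, X)"
  let ?proj = "\<lambda>(Y, X). (Y, X i)"
  have "?F \<Otimes>\<^sub>M ?F = distr M (?F \<Otimes>\<^sub>M ?F) (\<lambda>\<omega>. (v \<omega>, z \<omega>))"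
    using indep v z by (simp add: M.indep_var_distribution_eq)
  then have "?F \<Otimes>\<^sub>M ?F
      = distr (distr M (?F \<Otimes>\<^sub>M ?F) (\<lambda>\<omega>. (v \<omega>, z \<omega>))) (?F \<Otimes>\<^sub>M ?F) ?swap"
    using FF.distr_pair_swap by simp
  also have "\<dots> = distr M (?F \<Otimes>\<^sub>M ?F) (\<lambda>\<omega>. (z \<omega>, v \<omega>))"
    by (subst distr_distr[OF measurable_pair_swap' measurable_Pair[OF rv]]) (simp add: comp_def)
  finally have zv: "?F \<Otimes>\<^sub>M ?F = distr M (?F \<Otimes>\<^sub>M ?F) (\<lambda>\<omega>. (z \<omega>, v \<omega>))" .
  have Fi: "distr ?F ?N (\<lambda>X. X i) = ?N"
    unfolding std_normal_measure_def
    using i by (intro distr_PiM_component prob_space_std_normal) simp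
  have "?F \<Otimes>\<^sub>M ?N = distr ?F ?F (\<lambda>Y. Y) \<Otimes>\<^sub>M distr ?F ?N (\<lambda>X. X i)"
    by (simp only: Fi distr_id)
  also have "\<dots> = distr (?F \<Otimes>\<^sub>M ?F) (?F \<Otimes>\<^sub>M ?N) ?proj"
    by (rule pair_measure_distr)
      (simp_all only: Fi coord measurable_ident_sets N.sigma_finite_measure_axioms)
  also have "\<dots> = distr (distr M (?F \<Otimes>\<^sub>M ?F) (\<lambda>\<omega>. (z \<omega>, v \<omega>))) (?F \<Otimes>\<^sub>M ?N) ?proj"
    by (simp flip: zv)
  also have "\<dots> = distr M (?F \<Otimes>\<^sub>M ?N) (\<lambda>\<omega>. (z \<omega>, v \<omega> i))"
  proof (subst distr_distr)
    show "?proj \<in> measurable (?F \<Otimes>\<^sub>M ?F) (?F \<Otimes>\<^sub>M ?N)"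
      unfolding case_prod_beta
      by (rule measurable_Pair[OF measurable_fst measurable_compose[OF measurable_snd coord]])
  qed (use rv in \<open>simp_all add: comp_def\<close>)
  finally have joint: "?F \<Otimes>\<^sub>M ?N = distr M (?F \<Otimes>\<^sub>M ?N) (\<lambda>\<omega>. (z \<omega>, v \<omega> i))" .
  have pair: "(\<lambda>\<omega>. (z \<omega>, v \<omega> i)) \<in> measurable M (?F \<Otimes>\<^sub>M ?N)"
    using vi_rv rv(2) by simp
  let ?h = "\<lambda>(z, x). (diff_quot f i x z)^2"
  have int': "integrable M (\<lambda>\<omega>. ?h (z \<omega>, v \<omega> i))"
    using int by (subst (asm) joint) (rule integrable_distr[OF pair])
  have "C_gas d ?F M v z f $$ (i, i)
      = M.expectation (real_cond_exp M (vimage_algebra (space M) z ?F) (\<lambda>\<omega>. ?h (z \<omega>, v \<omega> i)))"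
    using i by (simp add: C_gas_def diff_quot_vec_def power2_eq_square)
  also have "\<dots> = M.expectation (\<lambda>\<omega>. ?h (z \<omega>, v \<omega> i))"
    by (rule S.real_cond_exp_int(2)[OF int'])
  also have "\<dots> = integral\<^sup>L (distr M (?F \<Otimes>\<^sub>M ?N) (\<lambda>\<omega>. (z \<omega>, v \<omega> i))) ?h"
    using int by (intro integral_distr[symmetric] pair) auto
  finally show ?thesis
    unfolding joint[symmetric] .
qed

lemma eigen_decomposition_diagonal:
  assumes "eigen_decomposition d C U lam" "i < d"
  shows "C $$ (i, i) = activity_score U lam d i"
proof -
  have U: "U \<in> carrier_mat d d" and C: "C = U * mat_diag d lam * transpose_mat U"
    using assms(1) by (auto simp: eigen_decomposition_def)
  show ?thesis
    unfolding C mat_diag_mult_right[OF U] activity_score_def using U \<open>i < d\<close>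
    by (auto simp: scalar_prod_def atLeast0LessThan power2_eq_square mult_ac intro!: sum.cong)
qed

theorem theorem3p8:
  fixes d i :: nat
    and A U :: "real mat"
    and b :: "real vec"
    and lam :: "nat \<Rightarrow> real"
    and M :: "'a measure"
    and v z :: "'a \<Rightarrow> nat \<Rightarrow> real"
  assumes "d \<ge> 1"
    and "A \<in> carrier_mat d d" and "transpose_mat A = A"
    and "b \<in> carrier_vec d"
    and "prob_space.variance (std_normal_measure d) (quadratic_fun d A b) > 0"
    and "prob_space M"
    and "prob_space.indep_var M (std_normal_measure d) v (std_normal_measure d) z"
    and "distr M (std_normal_measure d) v = std_normal_measure d"
    and "distr M (std_normal_measure d) z = std_normal_measure d"
    and "eigen_decomposition d
           (C_gas d (std_normal_measure d) M v z (quadratic_fun d A b)) U lam"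
    and "i < d"
  shows "upper_sobol d (\<lambda>_. std_normal_distribution) (quadratic_fun d A b) i =
         activity_score U lam d i /
           prob_space.variance (std_normal_measure d) (quadratic_fun d A b)"
proof -
  let ?f = "quadratic_fun d A b"
  let ?K = "std_normal_measure d \<Otimes>\<^sub>M std_normal_distribution"
  note mean_squares = quadratic_mean_squares[OF assms(2-4) \<open>i < d\<close>]
  have "activity_score U lam d i = (\<integral>(z, x). (diff_quot ?f i x z)^2 \<partial>?K)"
    using eigen_decomposition_diagonal[OF assms(10) \<open>i < d\<close>]
      C_gas_diagonal[OF assms(6-9) \<open>i < d\<close> mean_squares(1)] by simp
  then have "(\<integral>(z, x). (?f z - ?f (z(i := x)))^2 \<partial>?K) = 2 * activity_score U lam d i"
    using mean_squares(2) by simp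
  then show ?thesis
    by (simp add: upper_sobol_def Let_def std_normal_measure_def)
qed

end
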